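(* For every positive integer $n$ that is a multiple of $27$, $F_3(n) = \frac{5n}{9}$.
   Context: A star is a complete bipartite graph $K_{1,t}$. For an integer $k\ge 1$, a $k$-star-forest is a forest with at most $k$ connected components where each component is a star. A decomposition of a graph $G$ is a family of subgraphs of $G$ whose edge sets partition $E(G)$. $K_n$ denotes the complete graph on $n$ vertices. $F_k(n)$ denotes the minimum integer such that $K_n$ can be decomposed into $F_k(n)$ $k$-star-forests; thus $F_3(n)$ is the minimum number of $3$-star-forests into which $K_n$ can be decomposed. *)

theory Defs
  imports Complex_Main "HOL-Library.Disjoint_Sets"
begin

record 'a ugraph =
  verts :: "'a set"
  edges :: "'a set set"

definition simple_graph :: "'a ugraph \<Rightarrow> bool" where
  "simple_graph G \<longleftrightarrow>
     finite (verts G) \<and> (\<forall>e\<in>edges G. e \<subseteq> verts G \<and> card e = 2)"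

definition subgraph :: "'a ugraph \<Rightarrow> 'a ugraph \<Rightarrow> bool" where
  "subgraph H G \<longleftrightarrow>
     simple_graph H \<and> verts H \<subseteq> verts G \<and> edges H \<subseteq> edges G"

definition complete_graph :: "nat \<Rightarrow> nat ugraph" where
  "complete_graph n =
     \<lparr>verts = {..<n}, edges = {e. e \<subseteq> {..<n} \<and> card e = 2}\<rparr>"

definition complete_bipartite :: "'a set \<Rightarrow> 'a set \<Rightarrow> 'a ugraph" where
  "complete_bipartite A B =
     \<lparr>verts = A \<union> B, edges = {{a, b} | a b. a \<in> A \<and> b \<in> B}\<rparr>"

text \<open>The case \<open>t = 0\<close> of \<open>K\<^bsub>1,t\<^esub>\<close> (a single vertex) counts as a star. Excluding it
  would not change \<open>min_star_forests\<close> below, since isolated vertices of the subgraphs in a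
  decomposition can be discarded.\<close>

definition star :: "'a ugraph \<Rightarrow> bool" where
  "star G \<longleftrightarrow> (\<exists>A B. finite A \<and> finite B \<and> A \<inter> B = {} \<and> card A = 1 \<and>
                  G = complete_bipartite A B)"

definition induced_subgraph :: "'a ugraph \<Rightarrow> 'a set \<Rightarrow> 'a ugraph" where
  "induced_subgraph G U = \<lparr>verts = U, edges = {e \<in> edges G. e \<subseteq> U}\<rparr>"

definition reachable :: "'a ugraph \<Rightarrow> 'a \<Rightarrow> 'a \<Rightarrow> bool" where
  "reachable G u v \<longleftrightarrow> (u, v) \<in> {(x, y). {x, y} \<in> edges G}\<^sup>*"

definition components :: "'a ugraph \<Rightarrow> 'a ugraph set" where
  "components G = (\<lambda>u. induced_subgraph G {v \<in> verts G. reachable G u v}) ` verts G"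

definition cycle :: "'a ugraph \<Rightarrow> 'a list \<Rightarrow> bool" where
  "cycle G vs \<longleftrightarrow> length vs \<ge> 3 \<and> distinct vs \<and>
     (\<forall>i<length vs. {vs ! i, vs ! (Suc i mod length vs)} \<in> edges G)"

definition forest :: "'a ugraph \<Rightarrow> bool" where
  "forest G \<longleftrightarrow> simple_graph G \<and> (\<nexists>vs. cycle G vs)"

definition star_forest :: "nat \<Rightarrow> 'a ugraph \<Rightarrow> bool" where
  "star_forest k G \<longleftrightarrow>
     forest G \<and> card (components G) \<le> k \<and> (\<forall>C\<in>components G. star C)"

text \<open>Members of a decomposition may have no edges; this does not affect the minimum
  number of members, since such members can be discarded.\<close>

definition decomposition :: "'a ugraph \<Rightarrow> 'i set \<Rightarrow> ('i \<Rightarrow> 'a ugraph) \<Rightarrow> bool" where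
  "decomposition G I H \<longleftrightarrow>
     (\<forall>i\<in>I. subgraph (H i) G) \<and>
     disjoint_family_on (\<lambda>i. edges (H i)) I \<and>
     (\<Union>i\<in>I. edges (H i)) = edges G"

text \<open>\<open>F\<^sub>k(n)\<close>. For \<open>k \<ge> 1\<close> the minimum is over a nonempty set: \<open>K\<^sub>n\<close>
  decomposes into \<open>n\<close> stars, the \<open>i\<close>-th joining \<open>i\<close> to all larger vertices.\<close>

definition min_star_forests :: "nat \<Rightarrow> nat \<Rightarrow> nat" where
  "min_star_forests k n =
     (LEAST m. \<exists>H :: nat \<Rightarrow> nat ugraph.
        decomposition (complete_graph n) {..<m} H \<and> (\<forall>i<m. star_forest k (H i)))"

end

theory Submission
  imports Defs
begin

text \<open>In a decomposition into \<open>m\<close> star forests with at most \<open>k\<close> components, call the forests in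
  which a vertex is a centre its homes. The edge between two vertices lies in a home of
  exactly one of them, and in each other forest a vertex is a leaf of at most one star.

  Lower bound. Few forests mean few homes per vertex, but vertices with few homes get into
  each other's way. Vertices with a single home have different homes
  (\<open>homes_distinct\<close>), and a vertex with two homes cannot share both of them with single-home
  vertices (\<open>two_homes_avoid_single\<close>). Weighing these facts against the \<open>km\<close> available
  centres yields \<open>(2k - 1) n \<le> k\<^sup>2 m\<close> (\<open>star_forest_decomposition_bound\<close>), which for \<open>k = 3\<close>
  is \<open>5n \<le> 9m\<close>.

  Upper bound. A decomposition of \<open>K\<^bsub>n\<^esub>\<close> in which every vertex is a centre of some star can be
  blown up: from \<open>n\<close> vertices and \<open>m\<close> forests one gets \<open>tn\<close> vertices and \<open>tm\<close> forests
  (\<open>star_scheme_blow_up\<close>). So it is enough to decompose \<open>K\<^bsub>27\<^esub>\<close> into 15 forests. Equality in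
  the lower bound prescribes the homes, and then each edge only has to be assigned a place
  as a leaf attachment, which is a bipartite matching problem; imposing the translation
  symmetry of a \<open>3 \<times> 3\<close> grid makes the solution small enough to be written down
  (\<open>attach27\<close>).\<close>

section \<open>Reachability\<close>

lemma reachable_refl: "reachable G u u"
  by (simp add: reachable_def)

lemma reachable_edge: "{u, v} \<in> edges G \<Longrightarrow> reachable G u v"
  by (auto simp: reachable_def)

lemma reachable_trans: "reachable G u v \<Longrightarrow> reachable G v w \<Longrightarrow> reachable G u w"
  by (auto simp: reachable_def)

lemma reachable_sym: "reachable G u v \<Longrightarrow> reachable G v u"
proof -
  have "sym {(x, y). {x, y} \<in> edges G}"
    by (auto simp: sym_def insert_commute)
  then show "reachable G u v \<Longrightarrow> reachable G v u"
    unfolding reachable_def by (meson sym_rtrancl symD)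
qed

section \<open>Centres and the lower bound\<close>

text \<open>This is all that the counting argument uses about a star forest: each edge has one end in
  the set, and a vertex outside the set is a leaf.\<close>

definition centre_set :: "'a ugraph \<Rightarrow> 'a set \<Rightarrow> bool" where
  "centre_set G C \<longleftrightarrow>
     (\<forall>x y. {x, y} \<in> edges G \<longrightarrow> x \<in> C \<longleftrightarrow> y \<notin> C) \<and>
     (\<forall>v x y. v \<notin> C \<longrightarrow> {v, x} \<in> edges G \<longrightarrow> {v, y} \<in> edges G \<longrightarrow> x = y)"

text \<open>Take the centre of each component. A component is determined by any of its vertices, so a
  vertex belongs to the chosen set only if it is the centre of its own component; both
  properties can then be read off inside one component.\<close>

lemma star_forest_centre_set:
  assumes "star_forest k G"
  obtains C where "finite C" "card C \<le> k" "centre_set G C"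
proof -
  have sg: "simple_graph G" and ck: "card (components G) \<le> k"
    and st: "\<And>K. K \<in> components G \<Longrightarrow> star K"
    using assms by (auto simp: star_forest_def forest_def)
  define comp where "comp u = induced_subgraph G {v \<in> verts G. reachable G u v}" for u
  \<comment> \<open>For \<open>K\<^bsub>1,1\<^esub>\<close> either end can serve as the centre, hence a choice.\<close>
  define c where "c K = (SOME x. \<exists>B. x \<notin> B \<and> K = complete_bipartite {x} B)" for K :: "'a ugraph"
  have fin: "finite (components G)"
    using sg by (simp add: components_def simple_graph_def)
  have c: "\<exists>B. c K \<notin> B \<and> K = complete_bipartite {c K} B" if K: "K \<in> components G" for K
  proof -
    obtain A B where "A \<inter> B = {}" "card A = 1" "K = complete_bipartite A B"
      using st[OF K] by (auto simp: star_def)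
    then have "\<exists>x B. x \<notin> B \<and> K = complete_bipartite {x} B"
      by (metis card_1_singletonE disjoint_insert(1) inf_commute)
    then show ?thesis unfolding c_def by (rule someI_ex)
  qed
  have comp_in: "comp u \<in> components G" if "u \<in> verts G" for u
    using that by (auto simp: comp_def components_def)
  have comp_eq: "comp u = comp v" if "reachable G u v" for u v
  proof -
    have "{w \<in> verts G. reachable G u w} = {w \<in> verts G. reachable G v w}"
      using that reachable_sym[OF that] by (auto intro: reachable_trans)
    then show ?thesis by (simp add: comp_def)
  qed
  have comp_of_centre: "comp (c K) = K" if K: "K \<in> components G" for K
  proof -
    obtain u where u: "u \<in> verts G" "K = comp u"
      using K by (auto simp: components_def comp_def)
    obtain B where "K = complete_bipartite {c K} B" using c[OF K] by blast
    moreover have "r \<in> verts (complete_bipartite {r} B)" for r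
      by (simp add: complete_bipartite_def)
    ultimately have "c K \<in> verts K" by metis
    then have "reachable G u (c K)" using u by (auto simp: comp_def induced_subgraph_def)
    then show ?thesis using comp_eq u(2) by metis
  qed
  define C where "C = c ` components G"
  have centre_iff: "x \<in> C \<longleftrightarrow> x = c (comp x)" if "x \<in> verts G" for x
    using comp_of_centre comp_in[OF that] by (force simp: C_def)
  have edge: "x \<in> verts G \<and> y \<in> verts G \<and> comp y = comp x \<and>
      (x = c (comp x) \<longleftrightarrow> y \<noteq> c (comp x))" if e: "{x, y} \<in> edges G" for x y
  proof -
    have v: "x \<in> verts G" "y \<in> verts G" using e sg by (auto simp: simple_graph_def)
    have eq: "comp y = comp x" using comp_eq[OF reachable_edge[OF e]] by simp
    have "{x, y} \<in> edges (comp x)"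
      using e v by (auto simp: comp_def induced_subgraph_def reachable_refl reachable_edge)
    moreover obtain B where B: "c (comp x) \<notin> B" "comp x = complete_bipartite {c (comp x)} B"
      using c[OF comp_in[OF v(1)]] by blast
    moreover have "edges (complete_bipartite {r} B) = {{r, b} | b. b \<in> B}" for r
      by (auto simp: complete_bipartite_def)
    ultimately have "{x, y} \<in> {{c (comp x), b} | b. b \<in> B}" using B(2) by metis
    then obtain b where b: "b \<in> B" "{x, y} = {c (comp x), b}" by blast
    have "c (comp x) \<noteq> b" using b(1) B(1) by metis
    then show ?thesis using v eq b(2) unfolding doubleton_eq_iff by metis
  qed
  show ?thesis
  proof
    show "finite C" using fin by (simp add: C_def)
    show "card C \<le> k" using card_image_le[OF fin, of c] ck by (simp add: C_def)
    show "centre_set G C"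
      unfolding centre_set_def
    proof (intro conjI allI impI)
      fix x y assume "{x, y} \<in> edges G"
      then show "x \<in> C \<longleftrightarrow> y \<notin> C" using edge centre_iff by metis
    next
      fix v x y assume "v \<notin> C" "{v, x} \<in> edges G" "{v, y} \<in> edges G"
      then show "x = y" using edge centre_iff by metis
    qed
  qed
qed

locale centred_cover =
  fixes n m k :: nat and E :: "nat \<Rightarrow> nat set set" and C :: "nat \<Rightarrow> nat set"
  assumes cover: "\<lbrakk>x < n; y < n; x \<noteq> y\<rbrakk> \<Longrightarrow> \<exists>i<m. {x, y} \<in> E i"
    and fin: "i < m \<Longrightarrow> finite (C i)"
    and card_C: "i < m \<Longrightarrow> card (C i) \<le> k"
    and one_centre: "\<lbrakk>i < m; {x, y} \<in> E i\<rbrakk> \<Longrightarrow> x \<in> C i \<longleftrightarrow> y \<notin> C i"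
    and unique_nbr: "\<lbrakk>i < m; v \<notin> C i; {v, x} \<in> E i; {v, y} \<in> E i\<rbrakk> \<Longrightarrow> x = y"
begin

text \<open>An edge between \<open>x\<close> and \<open>y\<close> lies in a home of exactly one of them. A vertex with few homes
  is therefore tightly constrained: its edges lie in these few forests or are spread, one
  per forest, over the others.\<close>

definition homes :: "nat \<Rightarrow> nat set" where
  "homes v = {i. i < m \<and> v \<in> C i}"

lemma finite_homes: "finite (homes v)"
  by (simp add: homes_def)

lemma cover_home:
  assumes "x < n" "y < n" "x \<noteq> y"
  obtains i where "i < m" "{x, y} \<in> E i" "i \<in> homes x \<longleftrightarrow> i \<notin> homes y"
proof -
  obtain i where i: "i < m" "{x, y} \<in> E i" using cover[OF assms] by blast
  then show ?thesis using that[of i] one_centre[OF i] by (simp add: homes_def)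
qed

lemma no_home_bound:
  assumes v: "v < n" "homes v = {}"
  shows "n \<le> m + 1"
proof -
  define f where "f x = (SOME i. i < m \<and> {v, x} \<in> E i)" for x
  have f: "f x < m \<and> {v, x} \<in> E (f x)" if "x \<in> {..<n} - {v}" for x
    unfolding f_def by (rule someI_ex) (use cover[of v x] v that in auto)
  have "inj_on f ({..<n} - {v})"
  proof (rule inj_onI)
    fix x y assume "x \<in> {..<n} - {v}" "y \<in> {..<n} - {v}" "f x = f y"
    then show "x = y"
      using f[of x] f[of y] unique_nbr[of "f x" v x y] v by (auto simp: homes_def)
  qed
  moreover have "f ` ({..<n} - {v}) \<subseteq> {..<m}" using f by blast
  ultimately have "card ({..<n} - {v}) \<le> card {..<m}"
    by (metis card_inj_on_le finite_lessThan)
  then show ?thesis using v by simp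
qed

text \<open>Two vertices with the same homes would both be centres in every forest that could contain
  the edge between them. In particular no forest is the only home of two vertices.\<close>

lemma homes_distinct:
  assumes "x < n" "y < n" "homes x = homes y"
  shows "x = y"
  using assms cover_home[of x y] by metis

text \<open>In the configuration ruled out here, the edge \<open>uw\<close> must lie in the forest \<open>b\<close>, because \<open>u\<close>
  and \<open>w\<close> are both centres in \<open>a\<close>; so \<open>u\<close> is a leaf of \<open>w\<close> in \<open>b\<close>, and likewise \<open>v\<close> is a
  leaf of \<open>w\<close> in \<open>a\<close>. Neither forest then has room for the edge \<open>uv\<close>.\<close>

lemma two_homes_avoid_single:
  assumes uvw: "u < n" "v < n" "w < n"
    and u: "homes u = {a}" and v: "homes v = {b}" and w: "homes w = {a, b}"
  shows "a = b"
proof (rule ccontr)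
  assume ab: "a \<noteq> b"
  have m: "a < m" "b < m" using u v by (auto simp: homes_def)
  have C_iff: "x \<in> C a \<longleftrightarrow> a \<in> homes x" "x \<in> C b \<longleftrightarrow> b \<in> homes x" for x
    using m by (simp_all add: homes_def)
  have in_C: "u \<in> C a" "u \<notin> C b" "v \<in> C b" "v \<notin> C a" "w \<in> C a" "w \<in> C b"
    unfolding C_iff u v w using ab by simp_all
  have "u \<noteq> v" "u \<noteq> w" "v \<noteq> w" using u v w ab by auto
  obtain i where i: "{u, w} \<in> E i" "i \<in> homes u \<longleftrightarrow> i \<notin> homes w"
    using cover_home[of u w] uvw \<open>u \<noteq> w\<close> by blast
  then have uw: "{u, w} \<in> E b" using u w by auto
  obtain j where j: "{v, w} \<in> E j" "j \<in> homes v \<longleftrightarrow> j \<notin> homes w"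
    using cover_home[of v w] uvw \<open>v \<noteq> w\<close> by blast
  then have vw: "{v, w} \<in> E a" using v w by auto
  obtain l where l: "{u, v} \<in> E l" "l \<in> homes u \<longleftrightarrow> l \<notin> homes v"
    using cover_home[of u v] uvw \<open>u \<noteq> v\<close> by blast
  then consider "{v, u} \<in> E a" | "{u, v} \<in> E b" using u v by (auto simp: insert_commute)
  then show False
    using unique_nbr[OF m(1), of v u w] unique_nbr[OF m(2), of u v w] uw vw in_C
      \<open>u \<noteq> w\<close> \<open>v \<noteq> w\<close> by cases auto
qed

lemma sum_card_homes: "(\<Sum>v<n. card (homes v)) \<le> k * m"
proof -
  have "(\<Sum>v<n. card (homes v)) = (\<Sum>v<n. \<Sum>i<m. of_bool (v \<in> C i))"
    by (intro sum.cong refl) (simp add: homes_def sum.If_cases of_bool_def Int_def lessThan_def)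
  also have "\<dots> = (\<Sum>i<m. \<Sum>v<n. of_bool (v \<in> C i))" by (rule sum.swap)
  also have "\<dots> = (\<Sum>i<m. card ({..<n} \<inter> C i))"
    by (intro sum.cong refl) (simp add: sum.If_cases of_bool_def Int_def)
  also have "\<dots> \<le> (\<Sum>i<m. k)"
    by (intro sum_mono) (metis card_C card_mono fin inf_le2 le_trans lessThan_iff)
  finally show ?thesis by (simp add: mult.commute)
qed

text \<open>The vertices with one home occupy as many forests (the set \<open>T\<close> below). A vertex with two
  homes has one of them outside \<open>T\<close>, and the forests outside \<open>T\<close> have at most \<open>k\<close> centres
  each.\<close>

lemma single_and_double_bound:
  "k * card {v. v < n \<and> card (homes v) = 1} + card {v. v < n \<and> card (homes v) = 2} \<le> k * m"
proof -
  define S where "S = {v. v < n \<and> card (homes v) = 1}"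
  define D where "D = {v. v < n \<and> card (homes v) = 2}"
  define T where "T = {i. \<exists>v\<in>S. homes v = {i}}"
  have S: "\<exists>i. homes v = {i}" if "v \<in> S" for v
    using that by (auto simp: S_def card_1_singleton_iff)
  have TM: "T \<subseteq> {..<m}" by (auto simp: T_def homes_def)
  then have finT: "finite T" using finite_subset by blast
  have "inj_on (\<lambda>v. the_elem (homes v)) S"
    by (rule inj_onI) (metis (mono_tags, lifting) S S_def homes_distinct mem_Collect_eq the_elem_eq)
  moreover have "(\<lambda>v. the_elem (homes v)) ` S \<subseteq> T"
    using S by (force simp: T_def)
  ultimately have ST: "card S \<le> card T" using finT by (meson card_inj_on_le)
  have "D \<subseteq> (\<Union>i\<in>{..<m} - T. C i)"
  proof
    fix w assume w: "w \<in> D"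
    then obtain a b where ab: "homes w = {a, b}" "a \<noteq> b" by (auto simp: D_def card_2_iff)
    have "w < n" using w by (simp add: D_def)
    have "\<not> (a \<in> T \<and> b \<in> T)"
    proof
      assume "a \<in> T \<and> b \<in> T"
      then obtain u v where "u < n" "v < n" "homes u = {a}" "homes v = {b}"
        by (auto simp: T_def S_def)
      then show False using two_homes_avoid_single[of u v w a b] \<open>w < n\<close> ab by simp
    qed
    moreover have "{a, b} \<subseteq> {i. i < m \<and> w \<in> C i}"
      using ab(1) by (simp add: homes_def)
    ultimately show "w \<in> (\<Union>i\<in>{..<m} - T. C i)" by auto
  qed
  moreover have "finite (\<Union>i\<in>{..<m} - T. C i)" using fin by auto
  ultimately have "card D \<le> card (\<Union>i\<in>{..<m} - T. C i)" by (simp add: card_mono)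
  also have "\<dots> \<le> (\<Sum>i\<in>{..<m} - T. card (C i))" by (rule card_UN_le) simp
  also have "\<dots> \<le> (\<Sum>i\<in>{..<m} - T. k)" by (rule sum_mono) (use card_C in auto)
  also have "\<dots> = k * (m - card T)"
    using TM finT by (simp add: card_Diff_subset mult.commute)
  finally have "card D \<le> k * (m - card T)" .
  moreover have "k * card T + k * (m - card T) = k * m"
    using card_mono[OF finite_lessThan TM] by (simp flip: distrib_left)
  ultimately have "k * card T + card D \<le> k * m" by linarith
  moreover have "k * card S \<le> k * card T" using ST by simp
  ultimately show ?thesis unfolding S_def D_def by linarith
qed

text \<open>With \<open>n\<^sub>1\<close>, \<open>n\<^sub>2\<close>, \<open>n\<^sub>3\<close> the numbers of vertices with one, two, and at least three homes,
  counting centres gives \<open>n\<^sub>1 + 2n\<^sub>2 + 3n\<^sub>3 \<le> km\<close>, while the previous lemma gives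
  \<open>kn\<^sub>1 + n\<^sub>2 \<le> km\<close>. The first inequality taken \<open>k - 1\<close> times plus the second one gives
  \<open>n\<^sub>1\<close> and \<open>n\<^sub>2\<close> the common coefficient \<open>2k - 1\<close>. If some vertex has no home, at least \<open>n - 1\<close>
  forests are needed, which meets the bound once \<open>n \<ge> 4\<close>.\<close>

lemma forest_count_bound:
  assumes k: "k \<ge> 2" and n: "n \<ge> 4"
  shows "(2 * k - 1) * n \<le> k\<^sup>2 * m"
proof -
  obtain j where j: "k = j + 2" using k by (metis add.commute le_Suc_ex)
  show ?thesis
  proof (cases "\<exists>v<n. homes v = {}")
    case True
    then have "n \<le> m + 1" using no_home_bound by blast
    then obtain l where l: "m = l + 3" "n \<le> l + 4"
      using n by (intro that[of "m - 3"]) auto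
    have "(2 * k - 1) * n \<le> (2 * j + 3) * (l + 4)"
      using l by (intro mult_mono) (auto simp: j)
    also have "\<dots> \<le> (j + 2)\<^sup>2 * (l + 3)"
      by (simp add: power2_eq_square algebra_simps)
    finally show ?thesis by (simp add: l j)
  next
    case False
    define S where "S = {v. v < n \<and> card (homes v) = 1}"
    define D where "D = {v. v < n \<and> card (homes v) = 2}"
    \<comment> \<open>The combination of the two inequalities, vertex by vertex; \<open>k = j + 2\<close>.\<close>
    have weight: "2 * j + 3 \<le>
        (j + 1) * card (homes v) + ((j + 2) * of_bool (v \<in> S) + of_bool (v \<in> D))"
      if "v < n" for v
    proof -
      have "card (homes v) \<noteq> 0" using False that finite_homes by simp
      then consider "card (homes v) = 1" | "card (homes v) = 2" | "card (homes v) \<ge> 3" by linarith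
      then show ?thesis
      proof cases
        case 3
        then have "(j + 1) * 3 \<le> (j + 1) * card (homes v)" by (rule mult_le_mono2)
        then show ?thesis by simp
      qed (use that in \<open>auto simp: S_def D_def\<close>)
    qed
    have "(2 * j + 3) * n = (\<Sum>v<n. 2 * j + 3)" by simp
    also have "\<dots> \<le> (\<Sum>v<n. (j + 1) * card (homes v) +
        ((j + 2) * of_bool (v \<in> S) + of_bool (v \<in> D)))"
      by (rule sum_mono) (use weight in auto)
    also have "\<dots> = (j + 1) * (\<Sum>v<n. card (homes v)) +
        ((j + 2) * (\<Sum>v<n. of_bool (v \<in> S)) + (\<Sum>v<n. of_bool (v \<in> D)))"
      by (simp only: sum.distrib sum_distrib_left)
    also have "\<dots> = (j + 1) * (\<Sum>v<n. card (homes v)) + (k * card S + card D)"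
      by (simp add: j of_bool_def sum.If_cases Int_def S_def D_def conj_ac lessThan_def)
    also have "\<dots> \<le> (j + 1) * (k * m) + k * m"
      using sum_card_homes single_and_double_bound
      unfolding S_def D_def by (intro add_mono mult_le_mono2)
    also have "\<dots> = k\<^sup>2 * m" by (simp add: j power2_eq_square algebra_simps)
    finally show ?thesis by (simp add: j algebra_simps)
  qed
qed
end

lemma star_forest_decomposition_bound:
  assumes k: "k \<ge> 2" and n: "n \<ge> 4"
    and dec: "decomposition (complete_graph n) {..<m} H"
    and sf: "\<forall>i<m. star_forest k (H i)"
  shows "(2 * k - 1) * n \<le> k\<^sup>2 * m"
proof -
  have "\<exists>C. finite C \<and> card C \<le> k \<and> centre_set (H i) C" if "i < m" for i
    using star_forest_centre_set[of k "H i"] sf that by metis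
  then obtain C where C: "\<And>i. i < m \<Longrightarrow> finite (C i) \<and> card (C i) \<le> k \<and> centre_set (H i) (C i)"
    by metis
  interpret centred_cover n m k "\<lambda>i. edges (H i)" C
  proof
    fix x y assume "x < n" "y < n" "x \<noteq> y"
    then have "{x, y} \<in> edges (complete_graph n)" by (simp add: complete_graph_def)
    then show "\<exists>i<m. {x, y} \<in> edges (H i)" using dec by (auto simp: decomposition_def)
  next
    fix i assume "i < m"
    then show "finite (C i)" "card (C i) \<le> k" using C by blast+
  next
    fix i x y assume "i < m" "{x, y} \<in> edges (H i)"
    then show "x \<in> C i \<longleftrightarrow> y \<notin> C i" using C unfolding centre_set_def by meson
  next
    fix i v x y assume "i < m" "v \<notin> C i" "{v, x} \<in> edges (H i)" "{v, y} \<in> edges (H i)"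
    then show "x = y" using C unfolding centre_set_def by meson
  qed
  show ?thesis using forest_count_bound k n by blast
qed

section \<open>Star forests from leaf attachments\<close>

text \<open>A star forest is described by the partial map that sends each leaf to its centre. Vertices
  of \<open>V\<close> that are neither attached nor attached to are left out of the graph, since as
  isolated vertices they would count as components.\<close>

definition attach_graph :: "'a set \<Rightarrow> ('a \<Rightarrow> 'a option) \<Rightarrow> 'a ugraph" where
  "attach_graph V g =
     \<lparr>verts = {x \<in> V. g x \<noteq> None} \<union> {y \<in> V. \<exists>x\<in>V. g x = Some y},
      edges = {{x, y} | x y. x \<in> V \<and> g x = Some y}\<rparr>"

locale attachment =
  fixes V :: "'a set" and g :: "'a \<Rightarrow> 'a option"
  assumes finite_V: "finite V"
    and g_Some: "\<lbrakk>x \<in> V; g x = Some y\<rbrakk> \<Longrightarrow> y \<in> V \<and> g y = None"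
begin

abbreviation "G \<equiv> attach_graph V g"

lemma edge_iff:
  "{x, y} \<in> edges G \<longleftrightarrow> (x \<in> V \<and> g x = Some y) \<or> (y \<in> V \<and> g y = Some x)"
  by (auto simp: attach_graph_def doubleton_eq_iff)

lemma simple: "simple_graph G"
  unfolding simple_graph_def
proof (intro conjI ballI)
  show "finite (verts G)" using finite_V by (simp add: attach_graph_def)
  fix e assume "e \<in> edges G"
  then obtain x y where xy: "e = {x, y}" "x \<in> V" "g x = Some y" by (auto simp: attach_graph_def)
  show "e \<subseteq> verts G" using xy g_Some[of x y] by (auto simp: attach_graph_def)
  have "x \<noteq> y" using xy g_Some[of x y] by auto
  then show "card e = 2" using xy by simp
qed

lemma leaf_nbr:
  assumes v: "g v = Some c" and e: "{v, x} \<in> edges G"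
  shows "x = c"
  using e v g_Some[of x v] unfolding edge_iff by fastforce

text \<open>Some vertex of a cycle would be a leaf, but both of its neighbours on the cycle would have
  to be its centre.\<close>

lemma acyclic: "\<not> cycle G vs"
proof
  assume cyc: "cycle G vs"
  let ?l = "length vs"
  have l: "?l \<ge> 3" and d: "distinct vs"
    and e: "\<And>i. i < ?l \<Longrightarrow> {vs ! i, vs ! (Suc i mod ?l)} \<in> edges G"
    using cyc by (auto simp: cycle_def)
  have "{vs ! 0, vs ! 1} \<in> edges G" using e[of 0] l by force
  then have "g (vs ! 0) \<noteq> None \<or> g (vs ! 1) \<noteq> None" by (auto simp: edge_iff)
  moreover have "0 < ?l" "1 < ?l" using l by auto
  ultimately obtain j c where j: "j < ?l" "g (vs ! j) = Some c" by (metis not_None_eq)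
  define i where "i = (if j = 0 then ?l - 1 else j - 1)"
  have i: "i < ?l" "Suc i mod ?l = j" using j l by (auto simp: i_def)
  have next_j: "Suc j mod ?l < ?l" "Suc j mod ?l \<noteq> i"
    using j l by (auto simp: i_def mod_Suc)
  have "vs ! (Suc j mod ?l) = c" using leaf_nbr[OF j(2)] e[OF j(1)] by blast
  moreover have "vs ! i = c"
    using leaf_nbr[OF j(2), of "vs ! i"] e[OF i(1)] i(2) by (simp add: insert_commute)
  ultimately show False using d next_j i(1) by (metis nth_eq_iff_index_eq)
qed

definition hub :: "'a \<Rightarrow> 'a" where
  "hub x = (case g x of None \<Rightarrow> x | Some c \<Rightarrow> c)"

lemma reachable_iff_hub:
  assumes "u \<in> verts G" "v \<in> verts G"
  shows "reachable G u v \<longleftrightarrow> hub u = hub v"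
proof
  have attached: "hub x = hub y" if "x \<in> V" "g x = Some y" for x y
    using that g_Some[OF that] by (simp add: hub_def)
  have step: "hub x = hub y" if "{x, y} \<in> edges G" for x y
    using that attached[of x y] attached[of y x] unfolding edge_iff by metis
  assume "reachable G u v"
  then have "(u, v) \<in> {(x, y). {x, y} \<in> edges G}\<^sup>*" by (simp add: reachable_def)
  then show "hub u = hub v" by induction (use step in auto)
next
  have to_hub: "reachable G x (hub x)" if "x \<in> verts G" for x
  proof (cases "g x")
    case None
    then show ?thesis by (simp add: hub_def reachable_refl)
  next
    case (Some c)
    then have "x \<in> V" using that by (auto simp: attach_graph_def)
    then show ?thesis using Some by (simp add: hub_def reachable_edge edge_iff)
  qed
  assume "hub u = hub v"
  then show "reachable G u v"
    using to_hub assms by (metis reachable_sym reachable_trans)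
qed

lemma hub_centre:
  assumes "u \<in> verts G"
  shows "g (hub u) = None" "hub u \<in> {y \<in> V. \<exists>x\<in>V. g x = Some y}"
proof -
  have "g (hub u) = None \<and> hub u \<in> {y \<in> V. \<exists>x\<in>V. g x = Some y}"
  proof (cases "g u")
    case None
    then show ?thesis using assms by (auto simp: attach_graph_def hub_def)
  next
    case (Some c)
    then have "u \<in> V" using assms by (auto simp: attach_graph_def)
    then show ?thesis using Some g_Some[of u c] by (auto simp: hub_def)
  qed
  then show "g (hub u) = None" "hub u \<in> {y \<in> V. \<exists>x\<in>V. g x = Some y}" by blast+
qed

lemma component_eq:
  assumes "u \<in> verts G"
  shows "induced_subgraph G {v \<in> verts G. reachable G u v} =
    complete_bipartite {hub u} {x \<in> V. g x = Some (hub u)}"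
proof -
  have "{v \<in> verts G. reachable G u v} = {v \<in> verts G. hub v = hub u}"
    using reachable_iff_hub[OF assms] by auto
  moreover have "{v \<in> verts G. hub v = hub u} = {hub u} \<union> {x \<in> V. g x = Some (hub u)}"
    using hub_centre[OF assms] by (auto simp: hub_def attach_graph_def split: option.splits)
  moreover have "{e \<in> edges G. e \<subseteq> {hub u} \<union> {x \<in> V. g x = Some (hub u)}} =
      {{a, b} | a b. a \<in> {hub u} \<and> b \<in> {x \<in> V. g x = Some (hub u)}}" (is "?L = ?R")
  proof (rule set_eqI)
    fix e
    have "e \<in> ?R" if "e \<in> ?L"
    proof -
      have "e \<in> edges G" using that by blast
      then obtain x y where xy: "e = {x, y}" "x \<in> V" "g x = Some y"
        by (auto simp: attach_graph_def)
      have "g x \<noteq> None" using xy by simp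
      then have "x \<noteq> hub u" using hub_centre(1)[OF assms] by metis
      then have "g x = Some (hub u)" using that xy(1) by auto
      then show ?thesis using xy by (auto simp: insert_commute)
    qed
    moreover have "e \<in> ?L" if "e \<in> ?R"
    proof -
      obtain x where x: "e = {x, hub u}" "x \<in> V" "g x = Some (hub u)"
        using \<open>e \<in> ?R\<close> by (auto simp: insert_commute)
      then have "e \<in> edges G" by (auto simp: attach_graph_def)
      then show ?thesis using x by simp
    qed
    ultimately show "e \<in> ?L \<longleftrightarrow> e \<in> ?R" by blast
  qed
  ultimately show ?thesis
    by (simp add: induced_subgraph_def complete_bipartite_def)
qed

lemma star_forest:
  assumes "card {y \<in> V. \<exists>x\<in>V. g x = Some y} \<le> k"
  shows "star_forest k G"
proof -
  let ?S = "\<lambda>c. complete_bipartite {c} {x \<in> V. g x = Some c}"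
  let ?C = "{y \<in> V. \<exists>x\<in>V. g x = Some y}"
  have comp: "components G = (\<lambda>u. ?S (hub u)) ` verts G"
    unfolding components_def using component_eq by (intro image_cong) auto
  then have "components G \<subseteq> ?S ` ?C" using hub_centre(2) by blast
  moreover have "finite ?C" using finite_V by simp
  ultimately have "card (components G) \<le> card ?C" using surj_card_le by blast
  moreover have "star (?S (hub u))" if "u \<in> verts G" for u
  proof -
    have "g (hub u) = None"
      by (rule hub_centre(1)[OF that])
    then show ?thesis
      unfolding star_def using finite_V
      by (intro exI[of _ "{hub u}"] exI[of _ "{x \<in> V. g x = Some (hub u)}"]) auto
  qed
  ultimately show ?thesis
    using assms simple acyclic comp by (auto simp: star_forest_def forest_def)
qed

end

text \<open>\<open>a f x = Some y\<close> says that \<open>x\<close> is a leaf of \<open>y\<close> in the forest \<open>f\<close>.\<close>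

definition star_scheme ::
  "nat \<Rightarrow> 'v set \<Rightarrow> 'f set \<Rightarrow> ('f \<Rightarrow> 'v \<Rightarrow> 'v option) \<Rightarrow> bool" where
  "star_scheme k V F a \<longleftrightarrow>
     (\<forall>f\<in>F. (\<forall>x\<in>V. \<forall>y. a f x = Some y \<longrightarrow> y \<in> V \<and> a f y = None) \<and>
             card {y \<in> V. \<exists>x\<in>V. a f x = Some y} \<le> k) \<and>
     (\<forall>x\<in>V. \<forall>y\<in>V. x \<noteq> y \<longrightarrow> (\<exists>!f. f \<in> F \<and> (a f x = Some y \<or> a f y = Some x)))"

lemma star_schemeD:
  assumes "star_scheme k V F a"
  shows "\<lbrakk>f \<in> F; x \<in> V; a f x = Some y\<rbrakk> \<Longrightarrow> y \<in> V"
    and "\<lbrakk>f \<in> F; x \<in> V; a f x = Some y\<rbrakk> \<Longrightarrow> a f y = None"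
    and "f \<in> F \<Longrightarrow> card {y \<in> V. \<exists>x\<in>V. a f x = Some y} \<le> k"
    and "\<lbrakk>x \<in> V; y \<in> V; x \<noteq> y\<rbrakk> \<Longrightarrow> \<exists>!f. f \<in> F \<and> (a f x = Some y \<or> a f y = Some x)"
proof -
  note forests = assms[unfolded star_scheme_def, THEN conjunct1, rule_format]
  note pairs = assms[unfolded star_scheme_def, THEN conjunct2, rule_format]
  show "\<lbrakk>f \<in> F; x \<in> V; a f x = Some y\<rbrakk> \<Longrightarrow> y \<in> V"
    using forests[THEN conjunct1, rule_format] by blast
  show "\<lbrakk>f \<in> F; x \<in> V; a f x = Some y\<rbrakk> \<Longrightarrow> a f y = None"
    using forests[THEN conjunct1, rule_format] by blast
  show "f \<in> F \<Longrightarrow> card {y \<in> V. \<exists>x\<in>V. a f x = Some y} \<le> k"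
    by (rule forests[THEN conjunct2])
  show "\<lbrakk>x \<in> V; y \<in> V; x \<noteq> y\<rbrakk> \<Longrightarrow> \<exists>!f. f \<in> F \<and> (a f x = Some y \<or> a f y = Some x)"
    by (rule pairs)
qed

text \<open>Schemes are constructed on structured vertex and forest names; this moves them to initial
  segments of the natural numbers.\<close>

lemma star_scheme_transport:
  fixes a :: "'f \<Rightarrow> 'v \<Rightarrow> 'v option" and h :: "'w \<Rightarrow> 'v" and e :: "'g \<Rightarrow> 'f"
  assumes sch: "star_scheme k V F a" and fin: "finite V"
    and h: "bij_betw h W V" and e: "bij_betw e E F"
  shows "\<exists>b :: 'g \<Rightarrow> 'w \<Rightarrow> 'w option. star_scheme k W E b"
proof -
  define h' where "h' = inv_into W h"
  define b where "b i x = map_option h' (a (e i) (h x))" for i x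
  have h': "h' (h x) = x" if "x \<in> W" for x
    using that h by (simp add: h'_def bij_betw_inv_into_left)
  have hh': "h (h' y) = y" "h' y \<in> W" if "y \<in> V" for y
    using that h by (auto simp: h'_def bij_betw_inv_into_right bij_betw_def inv_into_into)
  have hV: "h x \<in> V" if "x \<in> W" for x using that h by (auto simp: bij_betw_def)
  have eF: "e i \<in> F" if "i \<in> E" for i using that e by (auto simp: bij_betw_def)
  note aV = star_schemeD(1,2)[OF sch]
  have b_iff: "b i x = Some y \<longleftrightarrow> a (e i) (h x) = Some (h y)"
    if "i \<in> E" "x \<in> W" "y \<in> W" for i x y
  proof (cases "a (e i) (h x)")
    case (Some w)
    then have "w \<in> V" using aV[OF eF[OF that(1)] hV[OF that(2)]] by blast
    then have "h' w = y \<longleftrightarrow> w = h y" using h'[OF that(3)] hh' by metis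
    then show ?thesis using Some by (simp add: b_def)
  qed (simp add: b_def)
  have b_W: "y \<in> W \<and> b i y = None" if "i \<in> E" "x \<in> W" "b i x = Some y" for i x y
  proof -
    obtain w where w: "a (e i) (h x) = Some w" "y = h' w" using \<open>b i x = Some y\<close> by (auto simp: b_def)
    then have "w \<in> V" "a (e i) w = None" using aV[OF eF[OF that(1)] hV[OF that(2)]] by blast+
    then show ?thesis using w(2) hh' by (simp add: b_def)
  qed
  have "star_scheme k W E b"
    unfolding star_scheme_def
  proof (intro conjI ballI allI impI)
    fix i x y assume "i \<in> E" "x \<in> W" "b i x = Some y"
    then show "y \<in> W" "b i y = None" using b_W by blast+
  next
    fix i assume i: "i \<in> E"
    have "h ` {y \<in> W. \<exists>x\<in>W. b i x = Some y} \<subseteq> {y \<in> V. \<exists>x\<in>V. a (e i) x = Some y}"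
      using b_iff[OF i] hV by auto
    moreover have "inj_on h {y \<in> W. \<exists>x\<in>W. b i x = Some y}"
      using h by (auto simp: bij_betw_def inj_on_def)
    moreover have "finite {y \<in> V. \<exists>x\<in>V. a (e i) x = Some y}" using fin by simp
    ultimately have "card {y \<in> W. \<exists>x\<in>W. b i x = Some y} \<le> card {y \<in> V. \<exists>x\<in>V. a (e i) x = Some y}"
      by (meson card_inj_on_le)
    then show "card {y \<in> W. \<exists>x\<in>W. b i x = Some y} \<le> k"
      using star_schemeD(3)[OF sch eF[OF i]] by linarith
  next
    fix x y assume xy: "x \<in> W" "y \<in> W" "x \<noteq> y"
    then have "h x \<noteq> h y" by (metis h')
    then obtain f where f: "f \<in> F" "a f (h x) = Some (h y) \<or> a f (h y) = Some (h x)"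
      and uniq: "\<And>f'. \<lbrakk>f' \<in> F; a f' (h x) = Some (h y) \<or> a f' (h y) = Some (h x)\<rbrakk> \<Longrightarrow> f' = f"
      using star_schemeD(4)[OF sch, of "h x" "h y"] xy hV by metis
    obtain i where i: "i \<in> E" "e i = f" using f(1) e by (auto simp: bij_betw_def)
    show "\<exists>!i. i \<in> E \<and> (b i x = Some y \<or> b i y = Some x)"
    proof (rule ex1I[of _ i])
      show "i \<in> E \<and> (b i x = Some y \<or> b i y = Some x)" using i f xy b_iff by auto
      fix j assume "j \<in> E \<and> (b j x = Some y \<or> b j y = Some x)"
      then have "e j = f" "j \<in> E" using uniq xy b_iff eF by blast+
      then show "j = i" using i e by (auto simp: bij_betw_def inj_on_def)
    qed
  qed
  then show ?thesis by blast
qed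

lemma decomposition_of_star_scheme:
  assumes "star_scheme k {..<n} {..<m} a"
  defines "H \<equiv> \<lambda>i. attach_graph {..<n} (a i)"
  shows "decomposition (complete_graph n) {..<m} H" and "\<forall>i<m. star_forest k (H i)"
proof -
  have att: "attachment {..<n} (a i)" if "i < m" for i
  proof
    show "finite {..<n}" by simp
    fix x y assume "x \<in> {..<n}" "a i x = Some y"
    then show "y \<in> {..<n} \<and> a i y = None"
      using star_schemeD(1,2)[OF assms(1), of i x y] that by simp
  qed
  show "\<forall>i<m. star_forest k (H i)"
    using attachment.star_forest[OF att] star_schemeD(3)[OF assms(1)] by (simp add: H_def)
  have ex1: "\<exists>!i. i < m \<and> {x, y} \<in> edges (H i)" if "x < n" "y < n" "x \<noteq> y" for x y
  proof -
    have "\<exists>!i. i < m \<and> (a i x = Some y \<or> a i y = Some x)"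
      using star_schemeD(4)[OF assms(1), of x y] that by simp
    moreover have "{x, y} \<in> edges (H i) \<longleftrightarrow> a i x = Some y \<or> a i y = Some x" if "i < m" for i
      using attachment.edge_iff[OF att[OF that]] \<open>x < n\<close> \<open>y < n\<close> by (simp add: H_def)
    ultimately show ?thesis by metis
  qed
  have simple: "simple_graph (H i)" if "i < m" for i
    using attachment.simple[OF att[OF that]] by (simp add: H_def)
  have verts: "verts (H i) \<subseteq> {..<n}" for i by (auto simp: H_def attach_graph_def)
  have edge: "\<exists>x y. e = {x, y} \<and> x < n \<and> y < n \<and> x \<noteq> y" if "i < m" "e \<in> edges (H i)" for i e
  proof -
    have "card e = 2" "e \<subseteq> {..<n}" using simple[OF that(1)] that(2) verts[of i]
      by (auto simp: simple_graph_def)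
    then show ?thesis by (auto simp: card_2_iff)
  qed
  show "decomposition (complete_graph n) {..<m} H"
    unfolding decomposition_def
  proof (intro conjI ballI)
    fix i assume "i \<in> {..<m}"
    then show "subgraph (H i) (complete_graph n)"
      using simple[of i] verts[of i] edge[of i] by (fastforce simp: subgraph_def complete_graph_def)
  next
    show "disjoint_family_on (\<lambda>i. edges (H i)) {..<m}"
      unfolding disjoint_family_on_def
    proof (intro ballI impI equals0I)
      fix i j e assume ij: "i \<in> {..<m}" "j \<in> {..<m}" "i \<noteq> j"
        and e: "e \<in> edges (H i) \<inter> edges (H j)"
      obtain x y where "e = {x, y}" "x < n" "y < n" "x \<noteq> y" using edge[of i e] ij e by auto
      then show False using ex1[of x y] ij e by auto
    qed
  next
    show "(\<Union>i\<in>{..<m}. edges (H i)) = edges (complete_graph n)"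
    proof (intro set_eqI iffI)
      fix e assume "e \<in> (\<Union>i\<in>{..<m}. edges (H i))"
      then obtain i where "i < m" "e \<in> edges (H i)" by blast
      then obtain x y where "e = {x, y}" "x < n" "y < n" "x \<noteq> y" using edge[of i e] by blast
      then show "e \<in> edges (complete_graph n)" by (simp add: complete_graph_def)
    next
      fix e assume "e \<in> edges (complete_graph n)"
      then obtain x y where "e = {x, y}" "x < n" "y < n" "x \<noteq> y"
        by (auto simp: complete_graph_def card_2_iff)
      then show "e \<in> (\<Union>i\<in>{..<m}. edges (H i))" using ex1 by blast
    qed
  qed
qed

section \<open>Blowing up a decomposition\<close>

text \<open>Vertices and forests are replaced by \<open>t\<close> copies each, and copy \<open>s\<close> of a forest has its
  centres in copy \<open>s\<close> of the vertices. An edge between different base vertices is inherited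
  from the base scheme. What remains are the pairs \<open>(s, v)\<close>, \<open>(r, v)\<close> over one base vertex:
  in the forest \<open>(s, home v)\<close> the vertex \<open>(s, v)\<close> is a centre, whereas \<open>(r, v)\<close> is still
  unattached, because \<open>v\<close> as a centre has no attachment in the base forest.\<close>

definition blow_up ::
  "('v \<Rightarrow> 'f) \<Rightarrow> ('f \<Rightarrow> 'v \<Rightarrow> 'v option) \<Rightarrow> nat \<times> 'f \<Rightarrow> nat \<times> 'v \<Rightarrow> (nat \<times> 'v) option" where
  "blow_up home a = (\<lambda>(s, f) (r, v).
     case a f v of
       Some c \<Rightarrow> Some (s, c)
     | None \<Rightarrow> if f = home v \<and> s < r then Some (s, v) else None)"

lemma star_scheme_blow_up:
  assumes sch: "star_scheme k V F a" and fin: "finite V"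
    and home: "\<And>v. v \<in> V \<Longrightarrow> home v \<in> F \<and> (\<exists>x\<in>V. a (home v) x = Some v)"
  shows "star_scheme k ({..<t} \<times> V) ({..<t} \<times> F) (blow_up home a)"
proof -
  let ?b = "blow_up home a"
  have aV: "y \<in> V" "a f y = None" if "f \<in> F" "x \<in> V" "a f x = Some y" for f x y
    using star_schemeD(1,2)[OF sch that] by blast+
  have a_home: "a (home v) v = None" if "v \<in> V" for v
    using home[OF that] aV by blast
  have b_iff: "?b (s, f) (r, v) = Some (s', w) \<longleftrightarrow>
      s' = s \<and> (a f v = Some w \<or> a f v = None \<and> f = home v \<and> s < r \<and> w = v)" for s f r v s' w
    by (auto simp: blow_up_def split: option.splits)
  show ?thesis
    unfolding star_scheme_def
  proof (intro conjI ballI allI impI)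
    fix i x y assume *: "i \<in> {..<t} \<times> F" "x \<in> {..<t} \<times> V" "?b i x = Some y"
    obtain s f r v s' w where eq: "i = (s, f)" "x = (r, v)" "y = (s', w)"
      by (metis surj_pair)
    have sw: "s' = s" "a f v = Some w \<or> a f v = None \<and> w = v"
      using *(3) unfolding eq b_iff by auto
    then show "y \<in> {..<t} \<times> V" using aV[of f v w] * by (auto simp: eq)
    have "a f w = None" using sw(2) aV[of f v w] * by (auto simp: eq)
    then show "?b i y = None" by (simp add: eq sw(1) blow_up_def)
  next
    fix i assume "i \<in> {..<t} \<times> F"
    then obtain s f where i: "i = (s, f)" "s < t" "f \<in> F" by auto
    have "{y \<in> {..<t} \<times> V. \<exists>x\<in>{..<t} \<times> V. ?b i x = Some y} \<subseteq> Pair s ` {y \<in> V. \<exists>x\<in>V. a f x = Some y}"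
    proof safe
      fix s' w r v assume *: "r < t" "v \<in> V" "s' < t" "w \<in> V" "?b i (r, v) = Some (s', w)"
      then have "s' = s" "a f v = Some w \<or> f = home w" unfolding i b_iff by auto
      then show "(s', w) \<in> Pair s ` {y \<in> V. \<exists>x\<in>V. a f x = Some y}"
        using * home[of w] by auto
    qed
    moreover have "finite {y \<in> V. \<exists>x\<in>V. a f x = Some y}" using fin by simp
    ultimately have "card {y \<in> {..<t} \<times> V. \<exists>x\<in>{..<t} \<times> V. ?b i x = Some y} \<le>
        card {y \<in> V. \<exists>x\<in>V. a f x = Some y}"
      by (meson surj_card_le)
    also have "\<dots> \<le> k" by (rule star_schemeD(3)[OF sch i(3)])
    finally show "card {y \<in> {..<t} \<times> V. \<exists>x\<in>{..<t} \<times> V. ?b i x = Some y} \<le> k" .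
  next
    fix x y assume xy: "x \<in> {..<t} \<times> V" "y \<in> {..<t} \<times> V" "x \<noteq> y"
    obtain r v s w where eq: "x = (r, v)" "y = (s, w)" by (metis surj_pair)
    have m: "r < t" "v \<in> V" "s < t" "w \<in> V" using xy by (auto simp: eq)
    have edge_iff: "?b (q, f) x = Some y \<or> ?b (q, f) y = Some x \<longleftrightarrow>
        q = s \<and> (a f v = Some w \<or> a f v = None \<and> f = home v \<and> s < r \<and> w = v) \<or>
        q = r \<and> (a f w = Some v \<or> a f w = None \<and> f = home w \<and> r < s \<and> v = w)" for q f
      unfolding eq b_iff by auto
    show "\<exists>!i. i \<in> {..<t} \<times> F \<and> (?b i x = Some y \<or> ?b i y = Some x)"
    proof (cases "v = w")
      case True
      then have "r \<noteq> s" using xy eq by simp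
      have self: "a f v \<noteq> Some v" if "f \<in> F" for f using aV[OF that m(2)] by fastforce
      show ?thesis
      proof (rule ex1I[of _ "(min r s, home v)"])
        show "(min r s, home v) \<in> {..<t} \<times> F \<and>
            (?b (min r s, home v) x = Some y \<or> ?b (min r s, home v) y = Some x)"
          unfolding edge_iff using True m \<open>r \<noteq> s\<close> home[OF m(2)] a_home[OF m(2)] by auto
        fix i assume i: "i \<in> {..<t} \<times> F \<and> (?b i x = Some y \<or> ?b i y = Some x)"
        obtain q f where qf: "i = (q, f)" by force
        show "i = (min r s, home v)"
          using i self[of f] True unfolding qf edge_iff by auto
      qed
    next
      case False
      then obtain f where f: "f \<in> F" "a f v = Some w \<or> a f w = Some v"
        and uniq: "\<And>f'. \<lbrakk>f' \<in> F; a f' v = Some w \<or> a f' w = Some v\<rbrakk> \<Longrightarrow> f' = f"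
        using star_schemeD(4)[OF sch m(2,4)] by metis
      define q where "q = (if a f v = Some w then s else r)"
      have excl: "a f v = Some w \<Longrightarrow> a f w \<noteq> Some v" using aV(2)[OF f(1) m(2)] by auto
      show ?thesis
      proof (rule ex1I[of _ "(q, f)"])
        show "(q, f) \<in> {..<t} \<times> F \<and> (?b (q, f) x = Some y \<or> ?b (q, f) y = Some x)"
          unfolding edge_iff using m f by (auto simp: q_def)
        fix i assume i: "i \<in> {..<t} \<times> F \<and> (?b i x = Some y \<or> ?b i y = Some x)"
        obtain q' f' where qf: "i = (q', f')" by force
        have *: "f' \<in> F" "q' = s \<and> a f' v = Some w \<or> q' = r \<and> a f' w = Some v"
          using i False unfolding qf edge_iff by auto
        then have "f' = f" using uniq by blast
        then show "i = (q, f)" using * excl f by (auto simp: qf q_def)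
      qed
    qed
  qed
qed

lemma decomposition_of_blow_up:
  fixes V :: "'v set" and F :: "'f set"
  assumes sch: "star_scheme k V F a" and fin: "finite V" "finite F"
    and home: "\<And>v. v \<in> V \<Longrightarrow> home v \<in> F \<and> (\<exists>x\<in>V. a (home v) x = Some v)"
  shows "\<exists>H :: nat \<Rightarrow> nat ugraph. decomposition (complete_graph (t * card V)) {..<t * card F} H \<and>
     (\<forall>i<t * card F. star_forest k (H i))"
proof -
  have "star_scheme k ({..<t} \<times> V) ({..<t} \<times> F) (blow_up home a)"
    using sch fin(1) home by (rule star_scheme_blow_up)
  moreover have "\<exists>h. bij_betw h {..<t * card V} ({..<t} \<times> V)"
    "\<exists>h. bij_betw h {..<t * card F} ({..<t} \<times> F)"
    using fin by (auto intro!: finite_same_card_bij simp: card_cartesian_product)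
  moreover have "finite ({..<t} \<times> V)" using fin by simp
  ultimately obtain b :: "nat \<Rightarrow> nat \<Rightarrow> nat option"
    where "star_scheme k {..<t * card V} {..<t * card F} b"
    using star_scheme_transport by metis
  then show ?thesis using decomposition_of_star_scheme by blast
qed

section \<open>The complete graph on 27 vertices\<close>

text \<open>Equality in the lower bound for \<open>n = 27\<close> and \<open>m = 15\<close> dictates the shape of the homes: nine
  vertices have one home, in nine different forests, and eighteen vertices have two homes,
  one among these nine forests and one among the other six. Each forest has three centres,
  so the eighteen vertices are the half-edges of a cubic multigraph whose edges are the nine
  forests and whose vertices are the six.

  This multigraph is taken to be \<open>K\<^bsub>3,3\<^esub>\<close>, with the rows and columns of a \<open>3 \<times> 3\<close> grid as its
  two sides and the cells as its edges. A position \<open>(p, q)\<close> carries the single-home vertex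
  \<open>(Cell, p, q)\<close> and the half-edges \<open>(Row, p, q)\<close> and \<open>(Col, p, q)\<close>, and all three are centres
  in the forest \<open>At p q\<close>. In addition \<open>InRow p\<close> has the three half-edges \<open>(Row, p, _)\<close> as
  centres, and \<open>InCol q\<close> the three half-edges \<open>(Col, _, q)\<close>.\<close>

datatype kind = Cell | Row | Col
datatype site = At nat nat | InRow nat | InCol nat

text \<open>Subtraction modulo \<open>3\<close> on the representatives \<open>0, 1, 2\<close>.\<close>

definition diff3 :: "nat \<Rightarrow> nat \<Rightarrow> nat" where
  "diff3 x y = (if y \<le> x then x - y else x + 3 - y)"

text \<open>The attachments are chosen invariant under translations of the grid modulo \<open>3\<close>, so they
  are governed by position differences (leaf minus centre). The pairs of vertices fall into
  39 translation classes: four classes within each kind, and nine classes for each two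
  kinds. There are 40 places for them. A forest \<open>At p q\<close> offers one place for each kind of
  leaf and each nonzero difference; the table \<open>cell_centre\<close> says which of the three centres
  receives that leaf. A forest \<open>InRow p\<close> offers one place for each kind of leaf and each row
  difference (not \<open>0\<close> for the kind \<open>Row\<close>, these being the centres), and \<open>row_shift\<close> gives the
  column difference to the receiving centre; \<open>InCol q\<close> is symmetric.

  Some choices are forced. A cell and a half-edge at the same position can meet only in the
  row or column of that half-edge, which fixes \<open>row_shift Cell 0\<close> and \<open>col_shift Cell 0\<close>.
  Hence the remaining \<open>Cell\<close>-\<open>Row\<close> and \<open>Row\<close>-\<open>Row\<close> pairs within a row must be placed in
  the forests \<open>At p q\<close>, where together with one \<open>Cell\<close>-\<open>Cell\<close> class they take up the
  differences \<open>(0, 1)\<close> and \<open>(0, 2)\<close> of the kinds \<open>Cell\<close> and \<open>Row\<close>; similarly for columns.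
  The rest is a matching of the remaining classes with the remaining places.\<close>

fun cell_centre :: "kind \<Rightarrow> nat \<times> nat \<Rightarrow> kind option" where
  "cell_centre Cell d =
     (if d \<in> {(0,1), (1,0), (1,1), (1,2)} then Some Cell
      else if d \<in> {(0,2), (2,2)} then Some Row
      else if d \<in> {(2,0), (2,1)} then Some Col else None)"
| "cell_centre Row d =
     (if d \<in> {(0,2), (2,2), (2,1), (1,2)} then Some Cell
      else if d \<in> {(0,1), (1,0)} then Some Row
      else if d \<in> {(2,0), (1,1)} then Some Col else None)"
| "cell_centre Col d =
     (if d \<in> {(2,0), (2,2), (2,1), (1,1)} then Some Cell
      else if d \<in> {(1,0), (0,1)} then Some Col
      else if d = (0,2) then Some Row else None)"

fun row_shift :: "kind \<Rightarrow> nat \<Rightarrow> nat option" where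
  "row_shift Cell r = Some 0"
| "row_shift Row r = (if r = 0 then None else Some 1)"
| "row_shift Col r = Some (if r = 0 then 0 else 1)"

fun col_shift :: "kind \<Rightarrow> nat \<Rightarrow> nat option" where
  "col_shift Cell r = Some 0"
| "col_shift Row r = Some (if r = 0 then 1 else if r = 1 then 2 else 0)"
| "col_shift Col r = (if r = 0 then None else Some 1)"

fun attach27 :: "site \<Rightarrow> kind \<times> nat \<times> nat \<Rightarrow> (kind \<times> nat \<times> nat) option" where
  "attach27 (At p q) (\<tau>, x, y) =
     map_option (\<lambda>\<sigma>. (\<sigma>, p, q)) (cell_centre \<tau> (diff3 x p, diff3 y q))"
| "attach27 (InRow p) (\<tau>, x, y) =
     map_option (\<lambda>s. (Row, p, diff3 y s)) (row_shift \<tau> (diff3 x p))"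
| "attach27 (InCol q) (\<tau>, x, y) =
     map_option (\<lambda>s. (Col, diff3 x s, q)) (col_shift \<tau> (diff3 y q))"

definition grid :: "(nat \<times> nat) list" where
  "grid = List.product [0, 1, 2] [0, 1, 2]"

definition vertices27 :: "(kind \<times> nat \<times> nat) list" where
  "vertices27 = List.product [Cell, Row, Col] grid"

definition forests15 :: "site list" where
  "forests15 = map (\<lambda>(p, q). At p q) grid @ map InRow [0, 1, 2] @ map InCol [0, 1, 2]"

fun home27 :: "kind \<times> nat \<times> nat \<Rightarrow> site" where
  "home27 (_, p, q) = At p q"

text \<open>By translation invariance one pair of each of the 39 classes would suffice, but
  evaluating the scheme on all pairs needs no further argument.\<close>

lemma attach27_pairs:
  "list_all (\<lambda>x. list_all (\<lambda>y. x = y \<or>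
     length (filter (\<lambda>f. attach27 f x = Some y \<or> attach27 f y = Some x) forests15) = 1)
     vertices27) vertices27"
  by code_simp

lemma attach27_leaves:
  "list_all (\<lambda>f. list_all (\<lambda>x. case attach27 f x of None \<Rightarrow> True
     | Some y \<Rightarrow> List.member vertices27 y \<and> attach27 f y = None) vertices27) forests15"
  by code_simp

lemma attach27_centres:
  "list_all (\<lambda>f. length (remdups (List.map_filter (attach27 f) vertices27)) \<le> 3) forests15"
  by code_simp

lemma attach27_home:
  "list_all (\<lambda>v. List.member forests15 (home27 v) \<and>
     list_ex (\<lambda>x. attach27 (home27 v) x = Some v) vertices27) vertices27"
  by code_simp

lemma distinct_names: "distinct vertices27" "distinct forests15"
  by code_simp+

lemma star_scheme_27: "star_scheme 3 (set vertices27) (set forests15) attach27"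
  unfolding star_scheme_def
proof (intro conjI ballI allI impI)
  fix f x y assume "f \<in> set forests15" "x \<in> set vertices27" "attach27 f x = Some y"
  then show "y \<in> set vertices27" "attach27 f y = None"
    using attach27_leaves by (fastforce simp: list_all_iff)+
next
  fix f assume f: "f \<in> set forests15"
  have "card {y \<in> set vertices27. \<exists>x\<in>set vertices27. attach27 f x = Some y} \<le>
      card (set (List.map_filter (attach27 f) vertices27))"
    by (intro card_mono) (force simp: map_filter_def)+
  also have "\<dots> = length (remdups (List.map_filter (attach27 f) vertices27))"
    by (rule card_set)
  also have "\<dots> \<le> 3" using attach27_centres f by (simp add: list_all_iff)
  finally show "card {y \<in> set vertices27. \<exists>x\<in>set vertices27. attach27 f x = Some y} \<le> 3" .
next
  fix x y assume "x \<in> set vertices27" "y \<in> set vertices27" "x \<noteq> y"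
  then have "length (filter (\<lambda>f. attach27 f x = Some y \<or> attach27 f y = Some x) forests15) = 1"
    using attach27_pairs unfolding list_all_iff by blast
  then obtain f where "filter (\<lambda>f. attach27 f x = Some y \<or> attach27 f y = Some x) forests15 = [f]"
    by (auto simp: length_Suc_conv)
  then have "{f \<in> set forests15. attach27 f x = Some y \<or> attach27 f y = Some x} = {f}"
    by (metis empty_set list.simps(15) set_filter)
  then have "f' \<in> set forests15 \<and> (attach27 f' x = Some y \<or> attach27 f' y = Some x) \<longleftrightarrow>
      f' = f" for f'
    by (simp only: set_eq_iff mem_Collect_eq singleton_iff)
  then show "\<exists>!f. f \<in> set forests15 \<and> (attach27 f x = Some y \<or> attach27 f y = Some x)"
    by (simp only: ex1_eq)
qed

lemma decomposition_27_multiple: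
  "\<exists>H :: nat \<Rightarrow> nat ugraph. decomposition (complete_graph (t * 27)) {..<t * 15} H \<and>
     (\<forall>i<t * 15. star_forest 3 (H i))"
proof -
  have "card (set vertices27) = 27" "card (set forests15) = 15"
    by (simp_all add: distinct_card[OF distinct_names(1)] distinct_card[OF distinct_names(2)]
        vertices27_def forests15_def grid_def)
  moreover have "home27 v \<in> set forests15 \<and> (\<exists>x\<in>set vertices27. attach27 (home27 v) x = Some v)"
    if "v \<in> set vertices27" for v
    using attach27_home that by (simp add: list_all_iff list_ex_iff)
  ultimately show ?thesis
    using decomposition_of_blow_up[OF star_scheme_27, of home27 t] by simp
qed

section \<open>The value of the minimum\<close>

theorem theorem1p4:
  fixes n :: nat
  assumes "n > 0" and "27 dvd n"
  shows "real (min_star_forests 3 n) = 5 * real n / 9"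
proof -
  obtain t where t: "n = t * 27" using assms(2) by (metis dvd_def mult.commute)
  have "min_star_forests 3 n = t * 15"
    unfolding min_star_forests_def
  proof (rule Least_equality)
    show "\<exists>H :: nat \<Rightarrow> nat ugraph. decomposition (complete_graph n) {..<t * 15} H \<and>
        (\<forall>i<t * 15. star_forest 3 (H i))"
      unfolding t by (rule decomposition_27_multiple)
  next
    fix m assume "\<exists>H :: nat \<Rightarrow> nat ugraph. decomposition (complete_graph n) {..<m} H \<and>
        (\<forall>i<m. star_forest 3 (H i))"
    moreover have "n \<ge> 4" using assms(1) t by simp
    ultimately have "(2 * 3 - 1) * n \<le> 3\<^sup>2 * m"
      using star_forest_decomposition_bound[of 3 n m] by auto
    then show "t * 15 \<le> m" using t by simp
  qed
  then show ?thesis using t by simp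
qed

end
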